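(* Let $f : \mathbb{C} \to \hat{\mathbb{C}}$ be a transcendental meromorphic function with at least one pole. Let $\mathcal{F}(f)$ be the set of all points of $\hat{\mathbb{C}}$ that have a neighbourhood in which all iterates $f^n$, $n\in\mathbb{N}$, are well defined and form a normal family. Then the classical Julia set $\hat{\mathbb{C}} \setminus \mathcal{F}(f)$ is equal to the set $$J(f):= \{ x \in \hat{\mathbb{C}} \setminus \overline{\mathcal{O}^{-}_{f}(\infty)} : \operatorname{card}(\hat{\mathbb{C}} \setminus \mathcal{O}^{+}_{f}(U_{x}))< \infty \text{ for all neighbourhoods } U_{x} \subset \hat{\mathbb{C}} \setminus \overline{\mathcal{O}^{-}_{f}(\infty)} \text{ of } x \} \cup \overline{\mathcal{O}^{-}_{f}(\infty)}.$$
   Context: $\hat{\mathbb{C}}=\mathbb{C}\cup\{\infty\}$ with the spherical metric; closures are taken in $\hat{\mathbb{C}}$. A meromorphic function on $\mathbb{C}$ is transcendental if it has an essential singularity at $\infty$ (i.e. $\lim_{|z|\to\infty} f(z)$ does not exist in $\hat{\mathbb{C}}$). The function $f$ is not defined at $\infty$, so an iterate $f^m$ is defined at a point $x$ only if $x, f(x),\dots,f^{m-1}(x)$ all lie in $\mathbb{C}$; $f^0$ is the identity on $\hat{\mathbb{C}}$. For $x\in\hat{\mathbb{C}}$, the backward orbit is $\mathcal{O}^{-}_{f}(x) := \bigcup_{m=0}^{\infty} f^{-m}(x)$, where $f^{-m}(x)$ is the set of points $y$ at which $f^m$ is defined with $f^m(y)=x$ (so $x \in \mathcal{O}^{-}_{f}(x)$).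 For a set $U \subset \mathbb{C} \setminus \mathcal{O}^{-}_{f}(\infty)$, the forward orbit is $\mathcal{O}^{+}_{f}(U) := \bigcup_{m=0}^{\infty} f^{m}(U)$. *)

theory Defs
  imports "HOL-Complex_Analysis.Complex_Analysis"
begin

section \<open>The Riemann sphere\<close>

datatype riemann_sphere = Fin complex | Infty

primrec stereographic :: "riemann_sphere \<Rightarrow> complex \<times> real" where
  "stereographic (Fin z) =
     ((2 / (1 + (cmod z)\<^sup>2)) *\<^sub>R z, ((cmod z)\<^sup>2 - 1) / ((cmod z)\<^sup>2 + 1))"
| "stereographic Infty = (0, 1)"

lemma inj_stereographic: "inj stereographic"
proof -
  have pos: "1 + (cmod z)\<^sup>2 > 0" for z
    by (simp add: add_pos_nonneg)
  have height: "((cmod z)\<^sup>2 - 1) / ((cmod z)\<^sup>2 + 1) = 1 - 2 / (1 + (cmod z)\<^sup>2)" for z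
    using pos[of z] by (simp add: field_simps)
  have fin: "z = w" if "stereographic (Fin z) = stereographic (Fin w)" for z w
  proof -
    have "2 / (1 + (cmod z)\<^sup>2) = 2 / (1 + (cmod w)\<^sup>2)"
      using that height[of z] height[of w] by simp
    moreover have "2 / (1 + (cmod w)\<^sup>2) \<noteq> 0"
      using pos[of w] by simp
    ultimately show ?thesis
      using that by simp
  qed
  have inf: "stereographic (Fin z) \<noteq> stereographic Infty" for z
    using pos[of z] height[of z] by simp
  show ?thesis
  proof (rule injI)
    fix x y assume "stereographic x = stereographic y"
    then show "x = y"
      using fin inf by (cases x; cases y) metis+
  qed
qed

text \<open>
  The spherical metric is taken in its chordal form, i.e. Euclidean distance on the unit sphere
  of \<open>\<complex> \<times> \<real>\<close>. It is bi-Lipschitz equivalent to the geodesic form, so closures, limits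
  and uniform convergence are the same for both.
\<close>

instantiation riemann_sphere :: metric_space
begin

definition dist_riemann_sphere :: "riemann_sphere \<Rightarrow> riemann_sphere \<Rightarrow> real" where
  "dist x y = dist (stereographic x) (stereographic y)"

definition uniformity_riemann_sphere :: "(riemann_sphere \<times> riemann_sphere) filter" where
  "(uniformity :: (riemann_sphere \<times> riemann_sphere) filter) = (INF e\<in>{0<..}. principal {(x, y). dist x y < e})"

definition open_riemann_sphere :: "riemann_sphere set \<Rightarrow> bool" where
  "open (U :: riemann_sphere set) \<longleftrightarrow> (\<forall>x\<in>U. eventually (\<lambda>(x', y). x' = x \<longrightarrow> y \<in> U) uniformity)"

instance
proof
  fix x y z :: riemann_sphere
  show "dist x y = 0 \<longleftrightarrow> x = y"
    using inj_stereographic by (auto simp: dist_riemann_sphere_def dest: injD)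
  show "dist x y \<le> dist x z + dist y z"
    unfolding dist_riemann_sphere_def by (rule dist_triangle2)
qed (simp_all add: uniformity_riemann_sphere_def open_riemann_sphere_def)

end


section \<open>Meromorphic functions and their iterates\<close>

primrec finite_part :: "riemann_sphere \<Rightarrow> complex" where
  "finite_part (Fin z) = z"
| "finite_part Infty = 0"

text \<open>
  \<open>nicely_meromorphic_on\<close> prescribes the value 0 at poles and continuity elsewhere, so this
  says that \<open>f\<close> is the sphere-valued extension of a meromorphic function. The constant \<open>Infty\<close>
  is excluded, since its finite part has no poles.
\<close>

definition meromorphic_map :: "(complex \<Rightarrow> riemann_sphere) \<Rightarrow> bool" where
  "meromorphic_map f \<longleftrightarrow>
     (\<lambda>z. finite_part (f z)) nicely_meromorphic_on UNIV \<and>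
     (\<forall>z. f z = Infty \<longleftrightarrow> is_pole (\<lambda>w. finite_part (f w)) z)"

definition transcendental_meromorphic :: "(complex \<Rightarrow> riemann_sphere) \<Rightarrow> bool" where
  "transcendental_meromorphic f \<longleftrightarrow>
     meromorphic_map f \<and> \<not> (\<exists>l. (f \<longlongrightarrow> l) at_infinity)"

text \<open>\<open>None\<close> means that the iterate is undefined at the point.\<close>

primrec iterate ::
    "(complex \<Rightarrow> riemann_sphere) \<Rightarrow> nat \<Rightarrow> riemann_sphere \<Rightarrow> riemann_sphere option" where
  "iterate f 0 x = Some x"
| "iterate f (Suc n) x =
     (case iterate f n x of Some (Fin z) \<Rightarrow> Some (f z) | _ \<Rightarrow> None)"

definition backward_orbit ::
    "(complex \<Rightarrow> riemann_sphere) \<Rightarrow> riemann_sphere \<Rightarrow> riemann_sphere set" where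
  "backward_orbit f x = (\<Union>m. {y. iterate f m y = Some x})"

definition forward_orbit ::
    "(complex \<Rightarrow> riemann_sphere) \<Rightarrow> riemann_sphere set \<Rightarrow> riemann_sphere set" where
  "forward_orbit f U = (\<Union>m. {y. \<exists>x\<in>U. iterate f m x = Some y})"


section \<open>Fatou and Julia sets\<close>

text \<open>
  On an open subset of the (locally compact) sphere, uniform convergence on compact subsets is
  the same as locally uniform convergence. The limit may take the value \<open>Infty\<close>.
\<close>

definition normal_family_on ::
    "riemann_sphere set \<Rightarrow> (riemann_sphere \<Rightarrow> riemann_sphere) set \<Rightarrow> bool" where
  "normal_family_on U \<F> \<longleftrightarrow>
     (\<forall>h :: nat \<Rightarrow> riemann_sphere \<Rightarrow> riemann_sphere. range h \<subseteq> \<F> \<longrightarrow>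
        (\<exists>r g. strict_mono r \<and>
           (\<forall>K. compact K \<longrightarrow> K \<subseteq> U \<longrightarrow> uniform_limit K (h \<circ> r) g sequentially)))"

definition fatou_set :: "(complex \<Rightarrow> riemann_sphere) \<Rightarrow> riemann_sphere set" where
  "fatou_set f =
     {x. \<exists>U. open U \<and> x \<in> U \<and>
        (\<forall>n. \<forall>y\<in>U. iterate f n y \<noteq> None) \<and>
        normal_family_on U (range (\<lambda>n y. the (iterate f n y)))}"

definition J_set :: "(complex \<Rightarrow> riemann_sphere) \<Rightarrow> riemann_sphere set" where
  "J_set f =
     {x \<in> UNIV - closure (backward_orbit f Infty).
        \<forall>U. open U \<longrightarrow> x \<in> U \<longrightarrow> U \<subseteq> UNIV - closure (backward_orbit f Infty) \<longrightarrow>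
          finite (UNIV - forward_orbit f U)}
     \<union> closure (backward_orbit f Infty)"

end

theory Submission
  imports Defs
begin

text \<open>
  Write \<open>B\<close> for the backward orbit of \<open>Infty\<close>. It is the set of points at which some iterate is
  undefined, so the Fatou set avoids the closure of \<open>B\<close>, and off this closure all iterates are
  holomorphic functions with finite values. What has to be compared, for a point \<open>x\<close> off this
  closure, is normality near \<open>x\<close> with the existence of a neighbourhood \<open>U\<close> whose forward orbit omits
  infinitely many points.

  If the forward orbit of \<open>U\<close> omits infinitely many points, then the iterates on \<open>U\<close> omit two common
  finite values, and Montel's criterion (\<open>montel_two_omitted_values\<close>) makes them normal.

  Suppose conversely that the iterates are normal on a neighbourhood \<open>U\<close> of \<open>x\<close>. The forward orbit of
  \<open>U\<close> avoids \<open>B\<close>, which settles the case that \<open>B\<close> is infinite. The delicate case is that \<open>B\<close> is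
  finite, for instance for self-maps of a punctured plane whose only pole is an omitted value
  (\<open>infinite_complement_of_forward_orbit\<close>). Suppose that all small neighbourhoods of \<open>x\<close> have
  cofinite forward orbits. Normality gives equicontinuity at \<open>x\<close>, so the orbit of \<open>x\<close> itself is dense
  in the sphere. Choose \<open>m \<ge> 1\<close> such that \<open>f\<^sup>m x\<close> is close to \<open>x\<close>. By equicontinuity \<open>f\<^sup>m\<close> moves every
  point of the orbit of \<open>x\<close> by less than \<open>\<epsilon>\<close>, and by density it moves no point off \<open>B\<close> by more than
  \<open>\<epsilon>\<close>. But \<open>Infty\<close> and a pole belong to \<open>B\<close> and have finitely many preimages, so by Picard's great
  theorem every other value is taken arbitrarily close to the essential singularity. Hence \<open>f\<^sup>m\<close> maps
  points arbitrarily close to \<open>Infty\<close> to any prescribed point off \<open>B\<close>, which is absurd if \<open>\<epsilon>\<close> is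
  small.
\<close>

section \<open>Topology of the sphere\<close>

lemma tendsto_sphere_iff:
  "(g \<longlongrightarrow> l) F \<longleftrightarrow> ((\<lambda>x. stereographic (g x)) \<longlongrightarrow> stereographic l) F"
  unfolding tendsto_dist_iff[of g] tendsto_dist_iff[of "\<lambda>x. stereographic (g x)"]
  by (simp add: dist_riemann_sphere_def)

lemma isCont_sphere_iff:
  "isCont g x \<longleftrightarrow> isCont (\<lambda>x. stereographic (g x)) x"
  unfolding isCont_def by (rule tendsto_sphere_iff)

lemma one_plus_norm_squared_nonzero [simp]: "1 + (cmod z)\<^sup>2 \<noteq> 0" "(cmod z)\<^sup>2 + 1 \<noteq> 0"
proof -
  have "1 + (cmod z)\<^sup>2 > 0" by (simp add: add_pos_nonneg)
  then show "1 + (cmod z)\<^sup>2 \<noteq> 0" "(cmod z)\<^sup>2 + 1 \<noteq> 0" by linarith+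
qed

lemma isCont_Fin: "isCont Fin z"
  unfolding isCont_sphere_iff by (auto intro!: continuous_intros)

lemma continuous_on_Fin: "continuous_on S Fin"
  by (simp add: continuous_at_imp_continuous_on isCont_Fin)

text \<open>
  Stereographic projection from the north pole inverts \<open>Fin\<close>. At the pole itself, division by zero
  yields exactly the value 0 that \<open>finite_part\<close> takes there.
\<close>

lemma finite_part_stereographic:
  "finite_part x = (1 / (1 - snd (stereographic x))) *\<^sub>R fst (stereographic x)"
proof (cases x)
  case (Fin z)
  have half_times: "(t / 2) * (2 / t) = 1" if "t \<noteq> 0" for t :: real
    using that by simp
  have "1 - snd (stereographic x) = 2 / (1 + (cmod z)\<^sup>2)"
    using Fin by (simp add: field_simps)
  then have "(1 / (1 - snd (stereographic x))) *\<^sub>R fst (stereographic x) =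
      (((1 + (cmod z)\<^sup>2) / 2) * (2 / (1 + (cmod z)\<^sup>2))) *\<^sub>R z"
    using Fin by (simp del: times_divide_eq_left times_divide_eq_right)
  also have "((1 + (cmod z)\<^sup>2) / 2) * (2 / (1 + (cmod z)\<^sup>2)) = 1"
    using half_times[OF one_plus_norm_squared_nonzero(1)[of z]] .
  finally show ?thesis
    using Fin by simp
qed simp

lemma continuous_on_stereographic: "continuous_on S stereographic"
  unfolding continuous_on_def using tendsto_sphere_iff[of "\<lambda>x. x"] tendsto_ident_at by blast

lemma snd_stereographic_eq_1: "snd (stereographic x) = 1 \<longleftrightarrow> x = Infty"
proof (cases x)
  case (Fin z)
  have "(cmod z)\<^sup>2 - 1 \<noteq> (cmod z)\<^sup>2 + 1"
    by simp
  with Fin show ?thesis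
    by (simp add: divide_eq_1_iff)
qed simp

lemma continuous_on_finite_part: "continuous_on (- {Infty}) finite_part"
proof -
  have "continuous_on (- {Infty})
      (\<lambda>x. (1 / (1 - snd (stereographic x))) *\<^sub>R fst (stereographic x))"
    by (intro continuous_intros continuous_on_stereographic ballI)
       (metis ComplD insertI1 right_minus_eq snd_stereographic_eq_1)
  then show ?thesis
    by (simp add: finite_part_stereographic[abs_def])
qed

lemma Fin_finite_part [simp]: "x \<noteq> Infty \<Longrightarrow> Fin (finite_part x) = x"
  by (cases x) auto

lemma open_image_Fin:
  assumes "open S"
  shows "open (Fin ` S)"
proof -
  have "open ((- {Infty}) \<inter> finite_part -` S)"
    by (intro continuous_open_preimage continuous_on_finite_part assms) (simp add: open_Compl)
  moreover have "(- {Infty}) \<inter> finite_part -` S = Fin ` S"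
    using Fin_finite_part by force
  ultimately show ?thesis
    by simp
qed

lemma open_vimage_Fin:
  assumes "open U"
  shows "open (Fin -` U)"
  by (simp add: assms continuous_on_Fin open_vimage)

lemma compact_image_finite_part:
  assumes "compact K" "Infty \<notin> K"
  shows "compact (finite_part ` K)"
  using assms by (intro compact_continuous_image continuous_on_subset[OF continuous_on_finite_part]) auto

text \<open>
  Inversion is the half turn \<open>(w, t) \<mapsto> (cnj w, - t)\<close> of the unit sphere, which is why the value
  at \<open>0\<close> fits into the same formula as the others.
\<close>

lemma stereographic_inverse:
  "stereographic (if u = 0 then Infty else Fin (inverse u)) =
     ((2 / (1 + (cmod u)\<^sup>2)) *\<^sub>R cnj u, (1 - (cmod u)\<^sup>2) / (1 + (cmod u)\<^sup>2))"
proof (cases "u = 0")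
  case False
  then have "inverse u = (1 / (cmod u)\<^sup>2) *\<^sub>R cnj u"
    using complex_div_cnj[of 1 u] by (simp add: scaleR_conv_of_real divide_inverse mult.commute)
  moreover define s where "s = (cmod u)\<^sup>2"
  ultimately have inv: "inverse u = (1 / s) *\<^sub>R cnj u"
    by simp
  have "s > 0"
    using False by (simp add: s_def)
  then have "2 / (1 + 1 / s) * (1 / s) = 2 / (1 + s)"
    by (simp add: field_simps)
  moreover have "(1 / s - 1) / (1 / s + 1) = (1 - s) / (1 + s)"
  proof -
    have frac: "1 / s - 1 = (1 - s) / s" "1 / s + 1 = (1 + s) / s"
      using \<open>s > 0\<close> by (simp_all add: field_simps)
    show ?thesis
      unfolding frac using \<open>s > 0\<close> by simp
  qed
  moreover have "(cmod (inverse u))\<^sup>2 = 1 / s"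
    unfolding s_def norm_inverse power_inverse by (rule inverse_eq_divide)
  ultimately show ?thesis
    using False s_def by (simp add: inv)
qed auto

lemma isCont_inversion: "isCont (\<lambda>u. if u = 0 then Infty else Fin (inverse u)) u"
  unfolding isCont_sphere_iff stereographic_inverse by (auto intro!: continuous_intros)

text \<open>
  The Moebius map \<open>u \<mapsto> a + c / u\<close> undoes the substitution \<open>u = c / (h - a)\<close>, which turns functions
  \<open>h\<close> that are large into functions \<open>u\<close> that are bounded. Its continuity at \<open>0\<close> converts convergence
  of \<open>u\<close> back to convergence of \<open>h\<close> in the sphere.
\<close>

lemma isCont_moebius:
  assumes "c \<noteq> 0"
  shows "isCont (\<lambda>u. if u = 0 then Infty else Fin (a + c / u)) u"
proof (cases "u = 0")
  case False
  have "isCont (\<lambda>u. Fin (a + c / u)) u"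
    by (intro continuous_intros isCont_o2[OF _ isCont_Fin]) (use False in auto)
  moreover have "\<forall>\<^sub>F v in nhds u. v \<noteq> 0"
    using False by (simp add: t1_space_nhds)
  then have "\<forall>\<^sub>F v in nhds u. (if v = 0 then Infty else Fin (a + c / v)) = Fin (a + c / v)"
    by eventually_elim simp
  ultimately show ?thesis
    using isCont_cong by fastforce
next
  case True
  \<comment> \<open>Near \<open>0\<close> the map is inversion after \<open>v \<mapsto> v / (a v + c)\<close>, which is regular at \<open>0\<close>.\<close>
  have "open {v. a * v + c \<noteq> 0}"
    by (intro open_Collect_neq continuous_intros)
  then have "\<forall>\<^sub>F v in nhds u. a * v + c \<noteq> 0"
    using assms True eventually_nhds_in_open[of "{v. a * v + c \<noteq> 0}" u] by simp
  then have "\<forall>\<^sub>F v in nhds u. (if v = 0 then Infty else Fin (a + c / v)) =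
      (if v / (a * v + c) = 0 then Infty else Fin (inverse (v / (a * v + c))))"
    by eventually_elim (auto simp: field_simps)
  moreover have "isCont (\<lambda>v. if v / (a * v + c) = 0 then Infty else Fin (inverse (v / (a * v + c)))) u"
    by (rule isCont_o2[OF _ isCont_inversion]) (use assms True in \<open>auto intro!: continuous_intros\<close>)
  ultimately show ?thesis
    using isCont_cong by fastforce
qed

lemma Fin_tendsto_Infty: "(Fin \<longlongrightarrow> Infty) at_infinity"
proof -
  have "((\<lambda>z. if inverse z = 0 then Infty else Fin (inverse (inverse z))) \<longlongrightarrow>
      (if (0::complex) = 0 then Infty else Fin (inverse 0))) at_infinity"
    by (rule isCont_tendsto_compose[OF isCont_inversion tendsto_inverse_0])
  moreover have "\<forall>\<^sub>F z in at_infinity.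
      (if inverse z = 0 then Infty else Fin (inverse (inverse z))) = Fin z"
    using eventually_not_equal_at_infinity[of "0::complex"] by eventually_elim simp
  ultimately show ?thesis
    using Lim_transform_eventually by fastforce
qed

lemma infinite_open_sphere:
  fixes V :: "riemann_sphere set"
  assumes "open V" "x \<in> V"
  shows "infinite V"
proof -
  have "Fin -` V \<noteq> {}"
  proof (cases x)
    case Infty
    then have "\<forall>\<^sub>F z in at_infinity. Fin z \<in> V"
      using Fin_tendsto_Infty assms topological_tendstoD by blast
    then have "\<exists>z. Fin z \<in> V"
      by (intro eventually_happens'[OF trivial_limit_at_infinity])
    then show ?thesis
      by auto
  qed (use assms in auto)
  then have "infinite (Fin -` V)"
    using assms(1) open_vimage_Fin finite_imp_not_open by blast
  then show ?thesis
    using finite_vimageI[of V Fin] by (auto simp: inj_def)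
qed

section \<open>Normal families\<close>

text \<open>
  Schottky's theorem turns the bound at the
  single point \<open>w\<close> into a bound on each compact set, so that Montel's theorem for locally bounded
  families applies. In the applications \<open>\<phi>\<close> is the Moebius map that recovers the original functions
  from normalised ones.
\<close>

lemma subsequence_convergent_in_sphere:
  fixes u :: "nat \<Rightarrow> complex \<Rightarrow> complex"
  assumes S: "open S" "connected S" "w \<in> S"
    and hol: "\<And>n. u n holomorphic_on S"
    and omit: "\<And>n z. z \<in> S \<Longrightarrow> u n z \<noteq> 0 \<and> u n z \<noteq> 1"
    and inf: "infinite {n. cmod (u n w) \<le> 1}"
    and cont: "\<And>z. isCont \<phi> z"
  obtains r :: "nat \<Rightarrow> nat" and g :: "complex \<Rightarrow> riemann_sphere"
  where "strict_mono r"
    "\<And>K. \<lbrakk>compact K; K \<subseteq> S\<rbrakk> \<Longrightarrow> uniform_limit K (\<lambda>n z. \<phi> (u (r n) z)) g sequentially"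
proof -
  obtain q :: "nat \<Rightarrow> nat" where q: "strict_mono q" "\<And>n. cmod (u (q n) w) \<le> 1"
    using infinite_enumerate[OF inf] by auto
  define H where "H = range (u \<circ> q)"
  have holH: "h holomorphic_on S" if "h \<in> H" for h
    using that hol by (auto simp: H_def)
  have bounded: "\<exists>B. \<forall>h\<in>H. \<forall>z\<in>K. cmod (h z) \<le> B" if K: "compact K" "K \<subseteq> S" for K
  proof -
    obtain B where "\<And>h z. \<lbrakk>h \<in> H; z \<in> K\<rbrakk> \<Longrightarrow> cmod (h z) \<le> B"
    proof (rule GPicard3[of S w H H K])
      show "h z \<noteq> 0 \<and> h z \<noteq> 1" if "h \<in> H" "z \<in> S" for h z
        using omit that by (auto simp: H_def)
      show "cmod (h w) \<le> 1" if "h \<in> H" for h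
        using q(2) that by (auto simp: H_def)
    qed (use S holH K in auto)
    then show ?thesis
      by blast
  qed
  have range: "range (u \<circ> q) \<subseteq> H"
    by (simp add: H_def)
  obtain g s where "strict_mono s" and s:
    "\<And>K. \<lbrakk>compact K; K \<subseteq> S\<rbrakk> \<Longrightarrow> uniform_limit K ((u \<circ> q) \<circ> s) g sequentially"
  proof (rule Montel[OF S(1) holH bounded range])
    fix g and r :: "nat \<Rightarrow> nat"
    assume "strict_mono r"
      and "\<And>K. \<lbrakk>compact K; K \<subseteq> S\<rbrakk> \<Longrightarrow> uniform_limit K ((u \<circ> q) \<circ> r) g sequentially"
    then show thesis
      by (rule that)
  qed
  show thesis
  proof (rule that[of "q \<circ> s" "\<lambda>z. \<phi> (g z)"])
    show "strict_mono (q \<circ> s)"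
      using q(1) \<open>strict_mono s\<close> by (rule strict_mono_o)
    fix K assume K: "compact K" "K \<subseteq> S"
    obtain B where B: "\<And>h z. \<lbrakk>h \<in> H; z \<in> K\<rbrakk> \<Longrightarrow> cmod (h z) \<le> B"
      using bounded[OF K] by auto
    \<comment> \<open>On \<open>K\<close> the functions take values in a compact disc, where \<open>\<phi>\<close> is uniformly continuous.\<close>
    have "uniformly_continuous_on (cball 0 B) \<phi>"
      by (simp add: compact_uniformly_continuous cont continuous_at_imp_continuous_on)
    from uniform_limit_compose_uniformly_continuous_on[OF s[OF K] this]
    show "uniform_limit K (\<lambda>n z. \<phi> (u ((q \<circ> s) n) z)) (\<lambda>z. \<phi> (g z)) sequentially"
      using B by (auto simp: H_def)
  qed
qed

text \<open>
  After normalising the omitted values to \<open>0\<close> and \<open>1\<close>, each function or its reciprocal is bounded by 1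
  at \<open>w\<close>, and reciprocals omit the same two values. Infinitely many members of the sequence fall under
  the same one of these cases.
\<close>

theorem montel_two_omitted_values:
  fixes h :: "nat \<Rightarrow> complex \<Rightarrow> complex"
  assumes S: "open S" "connected S" "w \<in> S"
    and hol: "\<And>n. h n holomorphic_on S"
    and "a \<noteq> b" and omit: "\<And>n z. z \<in> S \<Longrightarrow> h n z \<noteq> a \<and> h n z \<noteq> b"
  obtains r :: "nat \<Rightarrow> nat" and g :: "complex \<Rightarrow> riemann_sphere"
  where "strict_mono r"
    "\<And>K. \<lbrakk>compact K; K \<subseteq> S\<rbrakk> \<Longrightarrow> uniform_limit K (\<lambda>n z. Fin (h (r n) z)) g sequentially"
proof -
  define c where "c = b - a"
  have c: "c \<noteq> 0"
    using \<open>a \<noteq> b\<close> by (simp add: c_def)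
  define u where "u n z = (h n z - a) / c" for n z
  have hol_u: "u n holomorphic_on S" for n
    unfolding u_def by (intro holomorphic_intros hol) (use c in auto)
  have omit_u: "u n z \<noteq> 0 \<and> u n z \<noteq> 1" if "z \<in> S" for n z
    using omit[OF that, of n] c by (auto simp: u_def c_def)
  define v where "v n z = inverse (u n z)" for n z
  have hol_v: "v n holomorphic_on S" for n
    unfolding v_def by (intro holomorphic_intros hol_u) (use omit_u in auto)
  have omit_v: "v n z \<noteq> 0 \<and> v n z \<noteq> 1" if "z \<in> S" for n z
    using omit_u[OF that, of n] by (simp add: v_def)
  have "{n. cmod (u n w) \<le> 1} \<union> {n. cmod (v n w) \<le> 1} = UNIV"
    by (auto simp: v_def norm_inverse inverse_le_1_iff)
  then have "infinite {n. cmod (u n w) \<le> 1} \<or> infinite {n. cmod (v n w) \<le> 1}"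
    by (metis finite_Un infinite_UNIV_nat)
  then show thesis
  proof
    assume inf: "infinite {n. cmod (u n w) \<le> 1}"
    have cont: "isCont (\<lambda>t. Fin (a + c * t)) z" for z
      by (intro continuous_intros isCont_o2[OF _ isCont_Fin])
    have eq: "Fin (a + c * u n z) = Fin (h n z)" for n z
      using c by (simp add: u_def)
    show thesis
    proof (rule subsequence_convergent_in_sphere[of S w u "\<lambda>t. Fin (a + c * t)"])
      fix r :: "nat \<Rightarrow> nat" and g
      assume "strict_mono r"
        and "\<And>K. \<lbrakk>compact K; K \<subseteq> S\<rbrakk> \<Longrightarrow>
          uniform_limit K (\<lambda>n z. Fin (a + c * u (r n) z)) g sequentially"
      then show thesis
        unfolding eq by (rule that)
    qed (use S hol_u omit_u inf cont in auto)
  next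
    assume inf: "infinite {n. cmod (v n w) \<le> 1}"
    define \<phi> where "\<phi> t = (if t = 0 then Infty else Fin (a + c / t))" for t
    have cont: "isCont \<phi> z" for z
      unfolding \<phi>_def[abs_def] by (rule isCont_moebius[OF c])
    have eq: "\<phi> (v n z) = Fin (h n z)" if "z \<in> S" for n z
      using omit_u[OF that, of n] c by (simp add: \<phi>_def v_def u_def)
    show thesis
    proof (rule subsequence_convergent_in_sphere[of S w v \<phi>])
      fix r :: "nat \<Rightarrow> nat" and g
      assume r: "strict_mono r"
        and lim: "\<And>K. \<lbrakk>compact K; K \<subseteq> S\<rbrakk> \<Longrightarrow> uniform_limit K (\<lambda>n z. \<phi> (v (r n) z)) g sequentially"
      have "uniform_limit K (\<lambda>n z. Fin (h (r n) z)) g sequentially" if K: "compact K" "K \<subseteq> S" for K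
      proof (rule uniform_limitI)
        fix e :: real assume "e > 0"
        from uniform_limitD[OF lim[OF K] this]
        show "\<forall>\<^sub>F n in sequentially. \<forall>z\<in>K. dist (Fin (h (r n) z)) (g z) < e"
          by eventually_elim (use eq K in \<open>metis subsetD\<close>)
      qed
      with r show thesis
        by (rule that)
    qed (use S hol_v omit_v inf cont in auto)
  qed
qed

text \<open>
  This is the easy half of Arzela--Ascoli. Points \<open>\<alpha> k \<rightarrow> x\<close> witnessing a failure
  of equicontinuity form, together with \<open>x\<close>, a compact set; on it a subsequence converges uniformly,
  and the limit is continuous.
\<close>

lemma normal_family_imp_equicontinuous:
  assumes "open U" "x \<in> U" "x \<noteq> Infty" "normal_family_on U \<F>"
    and cont: "\<And>h. h \<in> \<F> \<Longrightarrow> continuous_on U h"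
    and "e > 0"
  obtains d where "d > 0" "\<And>y h. \<lbrakk>dist y x < d; h \<in> \<F>\<rbrakk> \<Longrightarrow> dist (h y) (h x) < e"
proof -
  define z where "z = finite_part x"
  have x: "x = Fin z"
    using assms(3) by (simp add: z_def)
  obtain d where d: "d > 0" "ball z d \<subseteq> Fin -` U"
    using openE[OF open_vimage_Fin[OF assms(1)], of z] assms(2) x by auto
  have "\<exists>d>0. \<forall>h\<in>\<F>. \<forall>\<zeta>. dist \<zeta> z < d \<longrightarrow> dist (h (Fin \<zeta>)) (h x) < e"
  proof (rule ccontr)
    assume "\<not> ?thesis"
    then have contr: "\<exists>h\<in>\<F>. \<exists>\<zeta>. dist \<zeta> z < \<delta> \<and> dist (h (Fin \<zeta>)) (h x) \<ge> e" if "\<delta> > 0" for \<delta>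
      using that by (auto simp: not_less dest!: spec[of _ \<delta>])
    have "\<exists>h \<zeta>. h \<in> \<F> \<and> dist \<zeta> z < d / Suc k \<and> dist (h (Fin \<zeta>)) (h x) \<ge> e" for k
    proof -
      have "d / Suc k > 0" using d by simp
      from contr[OF this] show ?thesis by blast
    qed
    then obtain h where "\<And>k. \<exists>\<zeta>. h k \<in> \<F> \<and> dist \<zeta> z < d / Suc k \<and> dist (h k (Fin \<zeta>)) (h k x) \<ge> e"
      by metis
    then obtain \<alpha> where h: "\<And>k. h k \<in> \<F>" and \<alpha>: "\<And>k. dist (\<alpha> k) z < d / Suc k"
        and far: "\<And>k. dist (h k (Fin (\<alpha> k))) (h k x) \<ge> e"
      by metis
    have "(\<lambda>k. dist (\<alpha> k) z) \<longlonglongrightarrow> 0"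
    proof (rule tendsto_sandwich[of "\<lambda>_. 0" _ _ "\<lambda>k. d / Suc k"])
      show "(\<lambda>k. d / Suc k) \<longlonglongrightarrow> 0"
        by (rule LIMSEQ_Suc[OF lim_const_over_n])
      show "\<forall>\<^sub>F k in sequentially. dist (\<alpha> k) z \<le> d / Suc k"
        using \<alpha> by (simp add: less_imp_le)
    qed auto
    then have lim_\<alpha>: "\<alpha> \<longlonglongrightarrow> z"
      using tendsto_dist_iff by blast
    define K where "K = Fin ` insert z (range \<alpha>)"
    have "compact K"
      unfolding K_def
      by (intro compact_continuous_image continuous_on_Fin compact_sequence_with_limit lim_\<alpha>)
    have "dist (\<alpha> k) z < d" for k
    proof -
      have "d / Suc k \<le> d" using d by (simp add: field_simps)
      then show ?thesis using \<alpha>[of k] by linarith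
    qed
    moreover have "Fin \<zeta> \<in> U" if "dist \<zeta> z < d" for \<zeta>
      using d(2) that by (auto simp: dist_commute subset_iff)
    ultimately have "K \<subseteq> U"
      using d(1) by (auto simp: K_def)
    have "range h \<subseteq> \<F>"
      using h by auto
    then have "\<exists>r g. strict_mono r \<and>
        (\<forall>K. compact K \<longrightarrow> K \<subseteq> U \<longrightarrow> uniform_limit K (h \<circ> r) g sequentially)"
      by (rule assms(4)[unfolded normal_family_on_def, rule_format])
    then obtain r g where r: "strict_mono r"
        and "\<forall>K. compact K \<longrightarrow> K \<subseteq> U \<longrightarrow> uniform_limit K (h \<circ> r) g sequentially"
      by (elim exE conjE)
    then have lim: "uniform_limit K (h \<circ> r) g sequentially"
      using \<open>compact K\<close> \<open>K \<subseteq> U\<close> by simp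
    have "continuous_on K g"
    proof (rule uniform_limit_theorem[OF _ lim])
      have "continuous_on K ((h \<circ> r) k)" for k
        using continuous_on_subset[OF cont[OF h] \<open>K \<subseteq> U\<close>] by simp
      then show "\<forall>\<^sub>F k in sequentially. continuous_on K ((h \<circ> r) k)"
        by simp
    qed simp
    have "(\<lambda>k. Fin (\<alpha> (r k))) \<longlonglongrightarrow> x"
      unfolding x
      by (rule isCont_tendsto_compose[OF isCont_Fin LIMSEQ_subseq_LIMSEQ[OF lim_\<alpha> r, unfolded o_def]])
    then have "(\<lambda>k. g (Fin (\<alpha> (r k)))) \<longlonglongrightarrow> g x"
      by (rule continuous_on_tendsto_compose[OF \<open>continuous_on K g\<close>]) (auto simp: K_def x)
    then have "\<forall>\<^sub>F k in sequentially. dist (g (Fin (\<alpha> (r k)))) (g x) < e / 3"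
      using \<open>e > 0\<close> by (intro tendstoD) auto
    moreover have "\<forall>\<^sub>F k in sequentially. \<forall>y\<in>K. dist (h (r k) y) (g y) < e / 3"
      using uniform_limitD[OF lim, of "e / 3"] \<open>e > 0\<close> by simp
    ultimately have "\<forall>\<^sub>F k in sequentially. False"
    proof eventually_elim
      case (elim k)
      have "Fin (\<alpha> (r k)) \<in> K" "x \<in> K"
        by (auto simp: K_def x)
      then have "dist (h (r k) (Fin (\<alpha> (r k)))) (g (Fin (\<alpha> (r k)))) < e / 3"
        "dist (h (r k) x) (g x) < e / 3"
        using elim(2) by auto
      then have "dist (h (r k) (Fin (\<alpha> (r k)))) (h (r k) x) < e"
        using elim(1) dist_triangle[of "h (r k) (Fin (\<alpha> (r k)))" "h (r k) x" "g (Fin (\<alpha> (r k)))"]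
          dist_triangle[of "g (Fin (\<alpha> (r k)))" "h (r k) x" "g x"] dist_commute[of "g x" "h (r k) x"]
        by linarith
      then show False
        using far[of "r k"] by simp
    qed
    then show False
      by simp
  qed
  then obtain d' where d': "d' > 0"
    "\<And>h \<zeta>. \<lbrakk>h \<in> \<F>; dist \<zeta> z < d'\<rbrakk> \<Longrightarrow> dist (h (Fin \<zeta>)) (h x) < e"
    by blast
  have "x \<in> Fin ` ball z d'"
    using x d'(1) by auto
  \<comment> \<open>The estimate was obtained for Euclidean distances and is carried over to the chordal metric.\<close>
  then obtain \<delta> where "\<delta> > 0" "ball x \<delta> \<subseteq> Fin ` ball z d'"
    using open_image_Fin[of "ball z d'"] open_contains_ball by blast
  show thesis
  proof (rule that)
    fix y h assume "dist y x < \<delta>" "h \<in> \<F>"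
    then obtain \<zeta> where "y = Fin \<zeta>" "dist \<zeta> z < d'"
      using \<open>ball x \<delta> \<subseteq> Fin ` ball z d'\<close> by (auto simp: dist_commute subset_iff)
    then show "dist (h y) (h x) < e"
      using d'(2) \<open>h \<in> \<F>\<close> by simp
  qed fact
qed

section \<open>Iterates\<close>

lemma iterate_add:
  "iterate f (m + n) x = (case iterate f n x of Some y \<Rightarrow> iterate f m y | None \<Rightarrow> None)"
  by (induction m) (auto split: option.splits riemann_sphere.splits)

lemma iterate_1 [simp]: "iterate f (Suc 0) (Fin z) = Some (f z)"
  by simp

text \<open>
  An iterate can become undefined only by passing through \<open>Infty\<close>, since \<open>f\<close> is defined at all
  finite points.
\<close>

lemma iterate_defined_iff:
  "x \<notin> backward_orbit f Infty \<longleftrightarrow> (\<forall>n. iterate f n x \<noteq> None)"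
proof
  assume x: "x \<notin> backward_orbit f Infty"
  have "iterate f n x \<noteq> None" for n
  proof (induction n)
    case (Suc n)
    then obtain y where y: "iterate f n x = Some y"
      by auto
    with x have "y \<noteq> Infty"
      by (auto simp: backward_orbit_def)
    with y show ?case
      by (cases y) auto
  qed simp
  then show "\<forall>n. iterate f n x \<noteq> None"
    by blast
next
  assume *: "\<forall>n. iterate f n x \<noteq> None"
  show "x \<notin> backward_orbit f Infty"
  proof
    assume "x \<in> backward_orbit f Infty"
    then obtain m where "iterate f m x = Some Infty"
      by (auto simp: backward_orbit_def)
    then have "iterate f (Suc m) x = None"
      by simp
    with * show False
      by blast
  qed
qed

lemma Infty_in_backward_orbit: "Infty \<in> backward_orbit f Infty"
  unfolding backward_orbit_def by (auto intro: exI[of _ 0])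

lemma backward_orbit_preimage:
  assumes "iterate f n x = Some y" "y \<in> backward_orbit f Infty"
  shows "x \<in> backward_orbit f Infty"
proof -
  obtain m where "iterate f m y = Some Infty"
    using assms(2) by (auto simp: backward_orbit_def)
  then have "iterate f (m + n) x = Some Infty"
    using assms(1) by (simp add: iterate_add)
  then show ?thesis
    by (auto simp: backward_orbit_def)
qed

lemma Fin_in_backward_orbit_iff:
  "Fin z \<in> backward_orbit f Infty \<longleftrightarrow> f z \<in> backward_orbit f Infty"
proof
  assume "Fin z \<in> backward_orbit f Infty"
  then obtain m where m: "iterate f m (Fin z) = Some Infty"
    by (auto simp: backward_orbit_def)
  then obtain k where "m = Suc k"
    by (cases m) auto
  then have "iterate f k (f z) = Some Infty"
    using m iterate_add[of f k "Suc 0" "Fin z"] by simp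
  then show "f z \<in> backward_orbit f Infty"
    by (auto simp: backward_orbit_def)
qed (rule backward_orbit_preimage[OF iterate_1])

lemma iterate_finite:
  assumes "x \<notin> backward_orbit f Infty"
  obtains z where "iterate f n x = Some (Fin z)"
proof -
  obtain y where y: "iterate f n x = Some y"
    using assms iterate_defined_iff by fastforce
  moreover have "y \<noteq> Infty"
    using assms y by (auto simp: backward_orbit_def)
  ultimately show thesis
    using that by (cases y) auto
qed

lemma the_iterate_add:
  assumes "x \<notin> backward_orbit f Infty"
  shows "the (iterate f (m + n) x) = the (iterate f m (the (iterate f n x)))"
  by (rule iterate_finite[OF assms, of n]) (simp add: iterate_add)

lemma analytic_at_non_pole:
  assumes "meromorphic_map f" "f z \<noteq> Infty"
  shows "(\<lambda>z. finite_part (f z)) analytic_on {z}"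
  using assms nicely_meromorphic_on_imp_analytic_at unfolding meromorphic_map_def by blast

lemma iterate_holomorphic:
  assumes "meromorphic_map f" and S: "\<And>z. z \<in> S \<Longrightarrow> Fin z \<notin> backward_orbit f Infty"
  shows "(\<lambda>z. finite_part (the (iterate f n (Fin z)))) holomorphic_on S"
proof (induction n)
  case (Suc n)
  let ?F = "\<lambda>z. finite_part (the (iterate f n (Fin z)))"
  \<comment> \<open>The next iterate is finite on \<open>S\<close> as well, so \<open>f\<close> is applied only at points that are not poles.\<close>
  have step: "iterate f n (Fin z) = Some (Fin (?F z))" "f (?F z) \<noteq> Infty"
      "finite_part (the (iterate f (Suc n) (Fin z))) = finite_part (f (?F z))" if zS: "z \<in> S" for z
  proof -
    obtain w where "iterate f n (Fin z) = Some (Fin w)"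
      using iterate_finite[OF S[OF zS]] .
    moreover obtain w' where "iterate f (Suc n) (Fin z) = Some (Fin w')"
      using iterate_finite[OF S[OF zS]] .
    ultimately show "iterate f n (Fin z) = Some (Fin (?F z))" "f (?F z) \<noteq> Infty"
      "finite_part (the (iterate f (Suc n) (Fin z))) = finite_part (f (?F z))"
      by auto
  qed
  have "(\<lambda>w. finite_part (f w)) analytic_on ?F ` S"
    unfolding analytic_on_analytic_at[of _ "?F ` S"]
    using analytic_at_non_pole[OF assms(1)] step(2) by blast
  then have "((\<lambda>w. finite_part (f w)) \<circ> ?F) holomorphic_on S"
    by (intro holomorphic_on_compose Suc analytic_imp_holomorphic)
  then show ?case
    by (rule holomorphic_transform) (use step(3) in simp)
qed simp

lemma continuous_on_iterate:
  assumes "meromorphic_map f" and A: "A \<inter> backward_orbit f Infty = {}"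
  shows "continuous_on A (\<lambda>x. the (iterate f n x))"
proof -
  let ?F = "\<lambda>z. finite_part (the (iterate f n (Fin z)))"
  have A': "Infty \<notin> A"
    using A Infty_in_backward_orbit by auto
  have Fin: "Fin (finite_part x) = x" if "x \<in> A" for x
    using A' that by (metis Fin_finite_part)
  have "?F holomorphic_on finite_part ` A"
    by (rule iterate_holomorphic[OF assms(1)]) (use A Fin in auto)
  then have "continuous_on A (\<lambda>x. ?F (finite_part x))"
    by (intro continuous_on_compose2[of _ ?F A finite_part] holomorphic_on_imp_continuous_on
        continuous_on_subset[OF continuous_on_finite_part]) (use A' in auto)
  then have "continuous_on A (\<lambda>x. Fin (?F (finite_part x)))"
    by (intro continuous_on_compose2[OF continuous_on_Fin[of UNIV]]) auto
  moreover have "Fin (?F (finite_part x)) = the (iterate f n x)" if x: "x \<in> A" for x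
  proof -
    have "x \<notin> backward_orbit f Infty"
      using A x by auto
    then obtain z where "iterate f n x = Some (Fin z)"
      by (rule iterate_finite)
    then show ?thesis
      using Fin[OF x] by simp
  qed
  ultimately show ?thesis
    using continuous_on_cong by fastforce
qed

section \<open>Preimages near the essential singularity\<close>

text \<open>
  In the coordinate \<open>u = 1 / z\<close>, a function that omits \<open>Infty\<close>, \<open>p\<close> and \<open>v\<close> near infinity is holomorphic
  in a punctured disc and omits two values there, so by Picard it has a limit in the sphere. The
  shift by \<open>p\<close> makes \<open>0\<close> one of the omitted values; only then does a limit of the reciprocal
  determine the limit of the function itself.
\<close>

lemma great_Picard_at_infinity:
  assumes f: "transcendental_meromorphic f"
    and poles: "\<forall>\<^sub>F z in at_infinity. f z \<noteq> Infty"
    and p: "\<forall>\<^sub>F z in at_infinity. f z \<noteq> Fin p"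
    and "v \<noteq> p"
  shows "\<exists>\<^sub>F z in at_infinity. f z = Fin v"
proof (rule ccontr)
  assume "\<not> ?thesis"
  then have "\<forall>\<^sub>F z in at_infinity. f z \<noteq> Fin v"
    by (simp add: not_frequently)
  with poles p have "\<forall>\<^sub>F z in at_infinity. f z \<noteq> Infty \<and> f z \<noteq> Fin p \<and> f z \<noteq> Fin v"
    by eventually_elim simp
  then have "\<forall>\<^sub>F u in at 0. f (inverse u) \<noteq> Infty \<and> f (inverse u) \<noteq> Fin p \<and> f (inverse u) \<noteq> Fin v"
    unfolding at_to_infinity eventually_filtermap by simp
  then obtain \<delta> where \<delta>: "\<delta> > 0" "\<And>u. u \<in> ball 0 \<delta> - {0} \<Longrightarrow>
      f (inverse u) \<noteq> Infty \<and> f (inverse u) \<noteq> Fin p \<and> f (inverse u) \<noteq> Fin v"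
    unfolding eventually_at by (auto simp: dist_commute)
  have mero: "meromorphic_map f" and no_lim: "\<not> (f \<longlongrightarrow> l) at_infinity" for l
    using f by (auto simp: transcendental_meromorphic_def)
  define F where "F u = finite_part (f (inverse u)) - p" for u
  have f_eq: "f (inverse u) = Fin (p + F u)" if "u \<in> ball 0 \<delta> - {0}" for u
    using \<delta>(2)[OF that] by (simp add: F_def)
  have F_omit: "F u \<noteq> 0 \<and> F u \<noteq> v - p" if "u \<in> ball 0 \<delta> - {0}" for u
    using \<delta>(2)[OF that] f_eq[OF that] by auto
  have F_hol: "F holomorphic_on ball 0 \<delta> - {0}"
  proof -
    have "(\<lambda>w. finite_part (f w)) analytic_on inverse ` (ball 0 \<delta> - {0})"
      unfolding analytic_on_analytic_at[of _ "inverse ` (ball 0 \<delta> - {0})"]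
      using analytic_at_non_pole[OF mero] \<delta>(2) by blast
    then have "((\<lambda>w. finite_part (f w)) \<circ> inverse) holomorphic_on ball 0 \<delta> - {0}"
      by (intro holomorphic_on_compose analytic_imp_holomorphic holomorphic_intros) auto
    then show ?thesis
      unfolding F_def by (intro holomorphic_intros) (simp add: o_def)
  qed
  obtain l where l: "(F \<longlongrightarrow> l) (at 0) \<or> ((inverse \<circ> F) \<longlongrightarrow> l) (at 0)"
    by (rule great_Picard[of "ball 0 \<delta>" 0 0 "v - p" F])
       (use \<delta>(1) F_hol F_omit \<open>v \<noteq> p\<close> in auto)
  have near: "\<forall>\<^sub>F u in at 0. u \<in> ball 0 \<delta> - {0}"
    using \<delta>(1) by (intro eventually_at_in_open) auto
  have "\<exists>L. ((\<lambda>u. f (inverse u)) \<longlongrightarrow> L) (at 0)"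
    using l
  proof
    assume "(F \<longlongrightarrow> l) (at 0)"
    then have "((\<lambda>u. Fin (p + F u)) \<longlongrightarrow> Fin (p + l)) (at 0)"
      by (intro isCont_tendsto_compose[OF isCont_Fin] tendsto_intros)
    moreover have "\<forall>\<^sub>F u in at 0. Fin (p + F u) = f (inverse u)"
      using near by eventually_elim (simp add: f_eq)
    ultimately show ?thesis
      by (intro exI) (rule Lim_transform_eventually)
  next
    define \<phi> where "\<phi> t = (if t = 0 then Infty else Fin (p + 1 / t))" for t
    assume "((inverse \<circ> F) \<longlongrightarrow> l) (at 0)"
    moreover have "isCont \<phi> l"
      unfolding \<phi>_def[abs_def] by (rule isCont_moebius) simp
    ultimately have "((\<lambda>u. \<phi> ((inverse \<circ> F) u)) \<longlongrightarrow> \<phi> l) (at 0)"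
      by (rule isCont_tendsto_compose[rotated])
    moreover have "\<forall>\<^sub>F u in at 0. \<phi> ((inverse \<circ> F) u) = f (inverse u)"
      using near by eventually_elim (use F_omit in \<open>simp add: f_eq \<phi>_def divide_inverse\<close>)
    ultimately show ?thesis
      by (intro exI) (rule Lim_transform_eventually)
  qed
  then obtain L where "((\<lambda>u. f (inverse u)) \<longlongrightarrow> L) (at 0)"
    by blast
  then have "(f \<longlongrightarrow> L) at_infinity"
    unfolding at_to_infinity filterlim_filtermap by simp
  with no_lim show False
    by blast
qed

text \<open>
  Preimages of points of the backward orbit belong to it again. If it is finite, then \<open>Infty\<close> and the
  pole \<open>p\<close> are therefore the two exceptional values that Picard's theorem permits.
\<close>

lemma preimages_when_backward_orbit_finite:
  assumes f: "transcendental_meromorphic f" and pole: "f p = Infty"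
    and fin: "finite (backward_orbit f Infty)"
    and v: "Fin v \<notin> backward_orbit f Infty"
  shows "\<exists>\<^sub>F z in at_infinity. f z = Fin v"
proof (rule great_Picard_at_infinity[OF f])
  have "finite (Fin -` backward_orbit f Infty)"
    using fin by (intro finite_vimageI) (auto simp: inj_def)
  then have "bounded (Fin -` backward_orbit f Infty)"
    by (rule finite_imp_bounded)
  then obtain R where R: "\<And>z. Fin z \<in> backward_orbit f Infty \<Longrightarrow> cmod z \<le> R"
    unfolding bounded_iff by auto
  have far: "\<forall>\<^sub>F z in at_infinity. Fin z \<notin> backward_orbit f Infty"
  proof (rule eventually_at_infinityI[of "R + 1"])
    fix z assume "R + 1 \<le> cmod z"
    then show "Fin z \<notin> backward_orbit f Infty"
      using R[of z] by fastforce
  qed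
  then show "\<forall>\<^sub>F z in at_infinity. f z \<noteq> Infty"
    by eventually_elim (use Fin_in_backward_orbit_iff Infty_in_backward_orbit in metis)
  have p: "Fin p \<in> backward_orbit f Infty"
    by (simp add: Fin_in_backward_orbit_iff pole Infty_in_backward_orbit)
  from far show "\<forall>\<^sub>F z in at_infinity. f z \<noteq> Fin p"
    by eventually_elim (use Fin_in_backward_orbit_iff p in metis)
  show "v \<noteq> p"
    using p v by auto
qed

section \<open>Comparison of the two sets\<close>

text \<open>
  Otherwise an iterate \<open>f\<^sup>m\<close> with \<open>m \<ge> 1\<close> would be within \<open>e\<close> of the identity, which Picard's theorem
  forbids near the essential singularity.
\<close>

lemma infinite_complement_of_forward_orbit:
  assumes f: "transcendental_meromorphic f" and pole: "f p = Infty"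
    and fin: "finite (backward_orbit f Infty)"
    and U: "open U" "x \<in> U" "U \<inter> backward_orbit f Infty = {}"
    and normal: "normal_family_on U (range (\<lambda>n y. the (iterate f n y)))"
  shows "\<exists>V. open V \<and> x \<in> V \<and> V \<subseteq> U \<and> infinite (UNIV - forward_orbit f V)"
proof (rule ccontr)
  assume "\<not> ?thesis"
  then have cofinite: "finite (UNIV - forward_orbit f V)" if "open V" "x \<in> V" "V \<subseteq> U" for V
    using that by blast
  define B where "B = backward_orbit f Infty"
  define it where "it n y = the (iterate f n y)" for n y
  have mero: "meromorphic_map f"
    using f by (simp add: transcendental_meromorphic_def)
  have xB: "x \<notin> B"
    using U by (auto simp: B_def)
  have "open (- B)"
    using fin by (simp add: B_def finite_imp_closed open_Compl)
  have equicontinuous: "\<exists>d>0. \<forall>n y. dist y x < d \<longrightarrow> dist (it n y) (it n x) < e" if e: "e > 0" for e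
  proof -
    have cont: "continuous_on U h" if "h \<in> range (\<lambda>n y. the (iterate f n y))" for h
      using that continuous_on_iterate[OF mero U(3)] by auto
    have "x \<noteq> Infty"
      using U Infty_in_backward_orbit by blast
    show ?thesis
    proof (rule normal_family_imp_equicontinuous[OF U(1,2) \<open>x \<noteq> Infty\<close> normal cont e])
      fix d assume "d > 0" and d: "\<And>y h. \<lbrakk>dist y x < d; h \<in> range (\<lambda>n y. the (iterate f n y))\<rbrakk> \<Longrightarrow>
        dist (h y) (h x) < e"
      have "dist (it n y) (it n x) < e" if "dist y x < d" for n y
        unfolding it_def by (rule d[OF that rangeI])
      with \<open>d > 0\<close> show ?thesis
        by blast
    qed
  qed
  have dense: "\<exists>n. it n x \<in> W" if "open W" "y \<in> W" for W y
  proof -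
    obtain e where e: "e > 0" "ball y e \<subseteq> W"
      using \<open>open W\<close> \<open>y \<in> W\<close> by (rule openE)
    then obtain d where d: "d > 0" "\<And>n a. dist a x < d \<Longrightarrow> dist (it n a) (it n x) < e / 2"
      using equicontinuous[of "e / 2"] by auto
    have "finite (UNIV - forward_orbit f (U \<inter> ball x d))"
      using U d(1) by (intro cofinite) auto
    moreover have "infinite (ball y (e / 2))"
      by (rule infinite_open_sphere[of _ y]) (use e in auto)
    ultimately have "\<not> ball y (e / 2) \<subseteq> UNIV - forward_orbit f (U \<inter> ball x d)"
      using finite_subset by blast
    then obtain y' where "y' \<in> ball y (e / 2)" "y' \<in> forward_orbit f (U \<inter> ball x d)"
      by blast
    then obtain n a where "iterate f n a = Some y'" "dist y y' < e / 2" "dist a x < d"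
      by (auto simp: forward_orbit_def dist_commute)
    then have "dist y y' < e / 2" "dist a x < d" "it n a = y'"
      by (simp_all add: it_def)
    with d(2) have "dist y y' < e / 2" "dist y' (it n x) < e / 2"
      by blast+
    then have "it n x \<in> ball y e"
      using dist_triangle[of y "it n x" y'] by simp
    with e(2) show ?thesis
      by blast
  qed
  obtain v where v: "Fin v \<notin> B"
  proof -
    have "infinite (UNIV - B)"
      using fin infinite_open_sphere[OF open_UNIV UNIV_I] by (simp add: B_def Diff_infinite_finite)
    then obtain y where "y \<in> UNIV - B"
      using infinite_imp_nonempty by blast
    moreover have "Infty \<in> B"
      by (simp add: B_def Infty_in_backward_orbit)
    ultimately show thesis
      using that by (cases y) auto
  qed
  \<comment> \<open>Points within \<open>e\<close> of \<open>Infty\<close> are more than \<open>e\<close> away from \<open>Fin v\<close>.\<close>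
  define e where "e = dist (Fin v) Infty / 2"
  have "e > 0"
    by (simp add: e_def)
  then obtain d where d: "d > 0" "\<And>n a. dist a x < d \<Longrightarrow> dist (it n a) (it n x) < e"
    using equicontinuous by blast
  \<comment> \<open>Since \<open>it 0 x = x\<close>, the second condition forces \<open>m \<ge> 1\<close>.\<close>
  obtain m where m: "dist (it m x) x < d" "it m x \<noteq> x"
  proof -
    have "infinite (ball x d)"
      by (rule infinite_open_sphere[of _ x]) (use d in auto)
    then have "infinite (ball x d - {x})"
      by simp
    then obtain y where "y \<in> ball x d - {x}"
      using infinite_imp_nonempty by blast
    then obtain m where "it m x \<in> ball x d - {x}"
      using dense[of "ball x d - {x}"] by auto
    then show thesis
      using that by (auto simp: dist_commute)
  qed
  \<comment> \<open>A violation would persist on an open set, hence occur at a point \<open>f\<^sup>n x\<close> of the dense orbit; there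
     \<open>f\<^sup>m (f\<^sup>n x) = f\<^sup>n (f\<^sup>m x)\<close> is close to \<open>f\<^sup>n x\<close> by equicontinuity.\<close>
  have near_identity: "dist (it m y) y \<le> e" if "y \<notin> B" for y
  proof (rule ccontr)
    assume "\<not> ?thesis"
    then have y: "y \<in> - B \<inter> (\<lambda>y. dist (it m y) y) -` {e<..}"
      using that by auto
    have "continuous_on (- B) (it m)"
      unfolding it_def by (rule continuous_on_iterate[OF mero]) (simp add: B_def)
    then have "continuous_on (- B) (\<lambda>y. dist (it m y) y)"
      by (intro continuous_intros)
    then have "open (- B \<inter> (\<lambda>y. dist (it m y) y) -` {e<..})"
      by (rule continuous_open_preimage) (use \<open>open (- B)\<close> in auto)
    from dense[OF this y] obtain n where "dist (it m (it n x)) (it n x) > e"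
      by auto
    moreover have "it m (it n x) = it n (it m x)"
      using the_iterate_add[of x f] xB unfolding it_def B_def by (metis add.commute)
    moreover have "dist (it n (it m x)) (it n x) < e"
      by (rule d(2)[OF m(1)])
    ultimately show False
      by simp
  qed
  have preimage: "\<exists>\<^sub>F z in at_infinity. f z = Fin w" if "Fin w \<notin> B" for w
    using preimages_when_backward_orbit_finite[OF f pole fin] that by (simp add: B_def)
  \<comment> \<open>Only the outermost preimage has to lie near \<open>Infty\<close>, so the first \<open>m - 1\<close> preimages of \<open>v\<close> are
     taken arbitrarily.\<close>
  have chain: "\<exists>u. Fin u \<notin> B \<and> iterate f k (Fin u) = Some (Fin w)" if "Fin w \<notin> B" for k w
    using that
  proof (induction k arbitrary: w)
    case (Suc k)
    obtain w' where w': "f w' = Fin w"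
      using frequently_ex[OF preimage[OF Suc.prems]] by auto
    then have "Fin w' \<notin> B"
      using Suc.prems Fin_in_backward_orbit_iff[of w' f] by (simp add: B_def)
    with Suc.IH obtain u where "Fin u \<notin> B" "iterate f k (Fin u) = Some (Fin w')"
      by blast
    with w' show ?case
      by (intro exI[of _ u]) simp
  qed auto
  obtain k where k: "m = k + Suc 0"
    using m(2) by (cases m) (auto simp: it_def)
  obtain u where u: "Fin u \<notin> B" "iterate f k (Fin u) = Some (Fin v)"
    using chain[OF v] by blast
  have "\<forall>\<^sub>F z in at_infinity. dist (Fin z) Infty < e"
    using tendstoD[OF Fin_tendsto_Infty \<open>e > 0\<close>] .
  from frequently_ex[OF frequently_eventually_frequently[OF preimage[OF u(1)] this]]
  obtain z where z: "f z = Fin u" "dist (Fin z) Infty < e"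
    by blast
  have "Fin z \<notin> B"
    using u(1) z(1) Fin_in_backward_orbit_iff[of z f] by (simp add: B_def)
  moreover have "it m (Fin z) = Fin v"
    using u(2) z(1) by (simp only: it_def k iterate_add iterate_1 option.case option.sel)
  ultimately have "dist (Fin v) (Fin z) \<le> e"
    using near_identity[of "Fin z"] by simp
  then have "dist (Fin v) Infty < 2 * e"
    using z(2) dist_triangle[of "Fin v" Infty "Fin z"] by simp
  then show False
    by (simp add: e_def)
qed

text \<open>
  Among infinitely many omitted points two are finite. Montel's criterion applies to the finite
  parts of the iterates on a disc in \<open>U\<close>, and its conclusion is carried over to the sphere.
\<close>

lemma in_fatou_set_if_infinite_complement:
  assumes mero: "meromorphic_map f"
    and U: "open U" "x \<in> U" "U \<inter> backward_orbit f Infty = {}"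
    and inf: "infinite (UNIV - forward_orbit f U)"
  shows "x \<in> fatou_set f"
proof -
  have "x \<noteq> Infty"
    using U Infty_in_backward_orbit by blast
  then obtain x0 where x: "x = Fin x0"
    by (cases x) auto
  obtain d where d: "d > 0" "ball x0 d \<subseteq> Fin -` U"
    using openE[OF open_vimage_Fin[OF U(1)], of x0] U(2) x by auto
  define S where "S = ball x0 d"
  have S: "open S" "connected S" "x0 \<in> S"
    using d(1) by (auto simp: S_def)
  have SU: "Fin z \<in> U" if "z \<in> S" for z
    using d(2) that by (auto simp: S_def)
  then have SB: "Fin z \<notin> backward_orbit f Infty" if "z \<in> S" for z
    using that U(3) by blast
  define F where "F n z = finite_part (the (iterate f n (Fin z)))" for n z
  have iter: "iterate f n (Fin z) = Some (Fin (F n z))" if "z \<in> S" for n z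
    by (rule iterate_finite[OF SB[OF that], of n]) (simp add: F_def)
  obtain a b where ab: "a \<noteq> b" "Fin a \<notin> forward_orbit f U" "Fin b \<notin> forward_orbit f U"
  proof -
    have "infinite (UNIV - forward_orbit f U - {Infty})"
      using inf by simp
    then obtain y where y: "y \<in> UNIV - forward_orbit f U - {Infty}"
      using infinite_imp_nonempty by blast
    have "infinite (UNIV - forward_orbit f U - {Infty} - {y})"
      using inf by simp
    then obtain y' where "y' \<in> UNIV - forward_orbit f U - {Infty} - {y}"
      using infinite_imp_nonempty by blast
    with y that[of "finite_part y" "finite_part y'"] show thesis
      by (cases y; cases y') auto
  qed
  have hol: "F n holomorphic_on S" for n
    unfolding F_def by (rule iterate_holomorphic[OF mero SB])
  have omit: "F n z \<noteq> a \<and> F n z \<noteq> b" if "z \<in> S" for n z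
  proof -
    have "Fin (F n z) \<in> forward_orbit f U"
      unfolding forward_orbit_def using iter[OF that] SU[OF that] by blast
    with ab show ?thesis
      by auto
  qed
  have "normal_family_on (Fin ` S) (range (\<lambda>n y. the (iterate f n y)))"
    unfolding normal_family_on_def
  proof (intro allI impI)
    fix h :: "nat \<Rightarrow> riemann_sphere \<Rightarrow> riemann_sphere"
    assume "range h \<subseteq> range (\<lambda>n y. the (iterate f n y))"
    then have "\<forall>j. \<exists>n. h j = (\<lambda>y. the (iterate f n y))"
      by blast
    then obtain N where N: "\<And>j. h j = (\<lambda>y. the (iterate f (N j) y))"
      by metis
    obtain r :: "nat \<Rightarrow> nat" and g where r: "strict_mono r" and lim:
      "\<And>K. \<lbrakk>compact K; K \<subseteq> S\<rbrakk> \<Longrightarrow> uniform_limit K (\<lambda>n z. Fin (F (N (r n)) z)) g sequentially"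
    proof (rule montel_two_omitted_values[of S x0 "\<lambda>j. F (N j)" a b])
      fix r :: "nat \<Rightarrow> nat" and g
      assume "strict_mono r"
        "\<And>K. \<lbrakk>compact K; K \<subseteq> S\<rbrakk> \<Longrightarrow> uniform_limit K (\<lambda>n z. Fin (F (N (r n)) z)) g sequentially"
      then show thesis
        by (rule that)
    qed (use S hol ab(1) omit in auto)
    have "uniform_limit K (h \<circ> r) (\<lambda>y. g (finite_part y)) sequentially"
      if K: "compact K" "K \<subseteq> Fin ` S" for K
    proof (rule uniform_limitI)
      have K': "compact (finite_part ` K)" "finite_part ` K \<subseteq> S"
        using K by (auto intro!: compact_image_finite_part)
      fix e :: real assume "e > 0"
      from uniform_limitD[OF lim[OF K'] this]
      show "\<forall>\<^sub>F n in sequentially. \<forall>y\<in>K. dist ((h \<circ> r) n y) (g (finite_part y)) < e"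
      proof eventually_elim
        case (elim n)
        show ?case
        proof
          fix y assume y: "y \<in> K"
          then obtain z where z: "y = Fin z" "z \<in> S"
            using K(2) by auto
          have "dist (Fin (F (N (r n)) (finite_part y))) (g (finite_part y)) < e"
            using elim y by blast
          then show "dist ((h \<circ> r) n y) (g (finite_part y)) < e"
            using z iter by (simp add: N)
        qed
      qed
    qed
    with r show "\<exists>r g. strict_mono r \<and>
        (\<forall>K. compact K \<longrightarrow> K \<subseteq> Fin ` S \<longrightarrow> uniform_limit K (h \<circ> r) g sequentially)"
      by blast
  qed
  moreover have "open (Fin ` S)" "x \<in> Fin ` S"
    using open_image_Fin S x by auto
  moreover have "\<forall>n. \<forall>y\<in>Fin ` S. iterate f n y \<noteq> None"
    using iter by auto
  ultimately show ?thesis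
    unfolding fatou_set_def by blast
qed

theorem theorem1p2:
  fixes f :: "complex \<Rightarrow> riemann_sphere"
  assumes "transcendental_meromorphic f"
    and "\<exists>p. f p = Infty"
  shows "UNIV - fatou_set f = J_set f"
proof -
  define B where "B = backward_orbit f Infty"
  obtain p where p: "f p = Infty"
    using assms(2) by blast
  have mero: "meromorphic_map f"
    using assms(1) by (simp add: transcendental_meromorphic_def)
  have "x \<notin> J_set f" if "x \<in> fatou_set f" for x
  proof -
    from that obtain U where U: "open U" "x \<in> U" and "\<forall>n. \<forall>y\<in>U. iterate f n y \<noteq> None"
      and normal: "normal_family_on U (range (\<lambda>n y. the (iterate f n y)))"
      by (auto simp only: fatou_set_def)
    then have UB: "U \<inter> B = {}"
      unfolding B_def using iterate_defined_iff by blast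
    then have UB': "U \<inter> closure B = {}"
      using U(1) by (simp add: open_Int_closure_eq_empty)
    have "\<exists>V. open V \<and> x \<in> V \<and> V \<subseteq> U \<and> infinite (UNIV - forward_orbit f V)"
    proof (cases "finite B")
      case True
      then show ?thesis
        using infinite_complement_of_forward_orbit[OF assms(1) p _ U _ normal] UB
        by (simp add: B_def)
    next
      case False
      \<comment> \<open>A forward image in \<open>B\<close> would put its starting point into \<open>B\<close>.\<close>
      have "B \<subseteq> UNIV - forward_orbit f U"
        using UB backward_orbit_preimage unfolding B_def forward_orbit_def by fastforce
      with False U show ?thesis
        using finite_subset by blast
    qed
    then obtain V where "open V" "x \<in> V" "V \<subseteq> U" "infinite (UNIV - forward_orbit f V)"
      by blast
    moreover have "x \<notin> closure B" "V \<subseteq> UNIV - closure B"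
      using UB' U(2) \<open>V \<subseteq> U\<close> by auto
    ultimately show ?thesis
      by (auto simp: J_set_def B_def)
  qed
  moreover have "x \<in> fatou_set f" if "x \<notin> J_set f" for x
  proof -
    have "\<exists>U. open U \<and> x \<in> U \<and> U \<subseteq> UNIV - closure B \<and> infinite (UNIV - forward_orbit f U)"
      using that by (auto simp: J_set_def B_def)
    then obtain U where U: "open U" "x \<in> U" "U \<subseteq> UNIV - closure B"
        "infinite (UNIV - forward_orbit f U)"
      by blast
    have "U \<inter> backward_orbit f Infty = {}"
      using U(3) closure_subset[of B] by (auto simp: B_def)
    then show ?thesis
      using in_fatou_set_if_infinite_complement[OF mero U(1,2) _ U(4)] by blast
  qed
  ultimately show ?thesis
    by blast
qed

end
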